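(* Fix integers $m\ge2$ and $n\ge0$. Define $$d^{max}_n:=\begin{cases}\left\lfloor \frac{3n+2}{4}\right\rfloor & \text{if } m=2,\\[2pt] n+1+(m-3)\left\lfloor\frac{n+2}{3}\right\rfloor & \text{otherwise.}\end{cases}$$ Let $C^d_n$ denote the number of $d$-dimensional cells (with one fewer counted when $d=0$) of the cell complex $X^m_n$ produced by the Comb Algorithm applied to $\mathrm{Ind}(\Delta^m_n)$. Then $C^d_n=0$ whenever $d>d^{max}_n$.
   Context: All graphs are finite and simple; $N(p)$ is the set of neighbors of $p$. $\mathrm{Ind}(G)$ is the independence complex of $G$: the simplicial complex on $V(G)$ whose faces are the independent sets of $G$ (including $\emptyset$); a face with $r$ vertices has dimension $r-1$. $Pa_\ell$ is the path on $\ell$ vertices; $\biguplus$ is disjoint union. Graphs. For $m\ge1,n\ge 1$, $Y^m_n$ is the extended star: a central vertex of degree $m$ with $m$ paths ("tendrils") of $n$ edges each emanating from it; $Y^m_0$ is a single vertex. $\widehat Y^m_n$ consists of two vertices $a,b$ joined by $m$ internally disjoint paths with $n+1$ edges each; the $k$-th vertex away from $a$ on the $j$-th path is $(j,k)$. For $n\ge 1$, $\Delta^m_n$ is $\widehat Y^m_{n+1}$ with $n$ additional vertices $1,\dots,n$ and additional edges $\{k,(j,k)\}$, $\{k,(j,k+1)\}$ for $j\in\{1,\dots,m\}$, $k\in\{1,\dots,n\}$. Also $\Delta^m_0:=\widehat Y^m_1$ and $\Delta^m_{-1}$ is a single vertex. Matching trees. For disjoint $A,B\subseteq V(G)$ let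 $\Sigma(A,B)=\{I\in\mathrm{Ind}(G): A\subseteq I,\ B\cap I=\emptyset\}$. A matching tree starts with the root $\Sigma(\emptyset,\emptyset)$; as long as some leaf $\Sigma(A,B)$ has at least two elements, perform one of: (1) if some $p\in V\setminus(A\cup B)$ has $N(p)\setminus(A\cup B)=\emptyset$, give the leaf one child labeled $\emptyset$ ($p$ is a free vertex); (2) if some $p\in V\setminus(A\cup B)$ has $N(p)\setminus(A\cup B)=\{v\}$, give the leaf one child $\Sigma(A\cup\{v\},B\cup N(v))$; (3) choose $v\in V\setminus(A\cup B)$ and give the leaf two children $\Sigma(A,B\cup\{v\})$ and $\Sigma(A\cup\{v\},B\cup N(v))$. The available graph at a node is the subgraph induced on $V\setminus(A\cup B)$. The critical cells are the faces $A$ for the nonempty final leaves $\Sigma(A,B)$. By discrete Morse theory, $\mathrm{Ind}(G)$ is homotopy equivalent to a cell complex with one $d$-cell for each $d$-dimensional critical cell, plus one extra $0$-cell (the base $0$-cell, present since $\emptyset$ is matched). Trees for auxiliary graphs. Path: repeatedly apply (2) with $p$ an end vertex and $v$ its neighbor, and (1) if an isolated vertex remains. $Y^m_n$ with $n\equiv 0 \bmod 3$: on each tendril in turn apply (2) starting from its leaf ($p$ the leaf, $v$ its neighbor, and so on) until the tendril is exhausted, then apply (1) to the central vertex. $Y^m_n$ with $n\not\equiv0\bmod 3$: apply (3) with $v$ the central vertex, then the path trees to the remaining disjoint paths. $\widehat Y^m_n$: apply (3) with $v=b$; the available graphs are then $Y^m_{n-1}$ and $Y^m_n$ (centered at $a$),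 to which the previous trees are applied. Comb Algorithm for $\mathrm{Ind}(\Delta^m_n)$ ($m\ge2$, $n\ge1$): for $k=1,\dots,n$ successively apply (3) with $v=k$ at $\Sigma(\emptyset,\{1,\dots,k-1\})$. Then: at $\Sigma(\{1\},N(1))$ apply (1) with $p=a$; at $\Sigma(\{k\},N(k)\cup\{1,\dots,k-1\})$ for $2\le k\le n-1$, the available graph is $Y^m_{k-1}\biguplus\Delta^m_{n-(k+1)}$, and one applies the tree of $Y^m_{k-1}$ and then, below any nonempty leaf, recursively the Comb Algorithm for $\Delta^m_{n-(k+1)}$ (the tree of $\widehat Y^m_1$ if $n-(k+1)=0$); at $\Sigma(\{n\},N(n)\cup\{1,\dots,n-1\})$ apply (1) with $p=b$; at $\Sigma(\emptyset,\{1,\dots,n\})$ the available graph is $\widehat Y^m_{n+1}$ and one applies its tree. $X^m_n$ ($n\ge1$) is the resulting cell complex, homotopy equivalent to $\mathrm{Ind}(\Delta^m_n)$; $X^m_0:=S^0$ (two $0$-cells). $C^d_n$ is the number of $d$-cells of $X^m_n$ for $d\ge1$, and $C^0_n$ is one less than the number of $0$-cells (so for $n\ge 1$, $C^d_n$ is the number of critical cells of dimension $d$); $C^d_n=0$ if $d<0$ or $n<0$. *)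

theory Defs
  imports Complex_Main
begin

record 'v graph =
  verts :: "'v set"
  edges :: "'v set set"

definition simple_graph :: "'v graph \<Rightarrow> bool" where
  "simple_graph G \<longleftrightarrow> finite (verts G) \<and> (\<forall>e\<in>edges G. e \<subseteq> verts G \<and> card e = 2)"

definition nbrs :: "'v graph \<Rightarrow> 'v \<Rightarrow> 'v set" where
  "nbrs G p = {q. {p, q} \<in> edges G}"

text \<open>The faces of the independence complex, including the empty one.\<close>

definition Ind :: "'v graph \<Rightarrow> 'v set set" where
  "Ind G = {I. I \<subseteq> verts G \<and> (\<forall>e\<in>edges G. \<not> e \<subseteq> I)}"

definition face_dim :: "'v set \<Rightarrow> int" where
  "face_dim I = int (card I) - 1"

definition Sigma_node :: "'v graph \<Rightarrow> 'v set \<Rightarrow> 'v set \<Rightarrow> 'v set set" where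
  "Sigma_node G A B = {I \<in> Ind G. A \<subseteq> I \<and> B \<inter> I = {}}"


section \<open>Matching trees\<close>

text \<open>
  A tree records only the choices made; the labels \<open>\<Sigma>(A, B)\<close> are recovered by
  descending from the root.  \<open>Free p\<close> is a node matched by the free vertex \<open>p\<close>, whose
  only child is the empty leaf; \<open>Match p v t\<close> is a node whose pivot \<open>p\<close> has the
  single available neighbour \<open>v\<close>; \<open>Split v t\<^sub>0 t\<^sub>1\<close> branches on \<open>v\<close>, with \<open>v\<close>
  excluded in \<open>t\<^sub>0\<close> and included in \<open>t\<^sub>1\<close>.
\<close>

datatype 'v mtree =
    Leaf
  | Free 'v
  | Match 'v 'v "'v mtree"
  | Split 'v "'v mtree" "'v mtree"

fun matching_tree_at :: "'v graph \<Rightarrow> 'v set \<Rightarrow> 'v set \<Rightarrow> 'v mtree \<Rightarrow> bool" where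
  "matching_tree_at G A B Leaf \<longleftrightarrow> card (Sigma_node G A B) < 2"
| "matching_tree_at G A B (Free p) \<longleftrightarrow>
     2 \<le> card (Sigma_node G A B) \<and> p \<in> verts G - (A \<union> B) \<and> nbrs G p - (A \<union> B) = {}"
| "matching_tree_at G A B (Match p v t) \<longleftrightarrow>
     2 \<le> card (Sigma_node G A B) \<and> p \<in> verts G - (A \<union> B) \<and> nbrs G p - (A \<union> B) = {v} \<and>
     matching_tree_at G (insert v A) (B \<union> nbrs G v) t"
| "matching_tree_at G A B (Split v t\<^sub>0 t\<^sub>1) \<longleftrightarrow>
     2 \<le> card (Sigma_node G A B) \<and> v \<in> verts G - (A \<union> B) \<and>
     matching_tree_at G A (insert v B) t\<^sub>0 \<and>
     matching_tree_at G (insert v A) (B \<union> nbrs G v) t\<^sub>1"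

definition matching_tree :: "'v graph \<Rightarrow> 'v mtree \<Rightarrow> bool" where
  "matching_tree G t \<longleftrightarrow> matching_tree_at G {} {} t"

text \<open>The pairs \<open>(A, B)\<close> of the leaves \<open>\<Sigma>(A, B)\<close>; the empty child of a free-vertex
  node contributes none.\<close>

fun final_leaves :: "'v graph \<Rightarrow> 'v set \<Rightarrow> 'v set \<Rightarrow> 'v mtree \<Rightarrow> ('v set \<times> 'v set) set" where
  "final_leaves G A B Leaf = {(A, B)}"
| "final_leaves G A B (Free p) = {}"
| "final_leaves G A B (Match p v t) = final_leaves G (insert v A) (B \<union> nbrs G v) t"
| "final_leaves G A B (Split v t\<^sub>0 t\<^sub>1) =
     final_leaves G A (insert v B) t\<^sub>0 \<union> final_leaves G (insert v A) (B \<union> nbrs G v) t\<^sub>1"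

definition critical_cells :: "'v graph \<Rightarrow> 'v mtree \<Rightarrow> 'v set set" where
  "critical_cells G t = {A. \<exists>B. (A, B) \<in> final_leaves G {} {} t \<and> Sigma_node G A B \<noteq> {}}"

text \<open>Continue with \<open>s\<close> below every nonempty leaf of \<open>t\<close>.\<close>

primrec graft :: "'v mtree \<Rightarrow> 'v mtree \<Rightarrow> 'v mtree" where
  "graft Leaf s = s"
| "graft (Free p) s = Free p"
| "graft (Match p v t) s = Match p v (graft t s)"
| "graft (Split v t\<^sub>0 t\<^sub>1) s = Split v (graft t\<^sub>0 s) (graft t\<^sub>1 s)"


section \<open>The graphs\<close>

text \<open>
  \<open>VA\<close> and \<open>VB\<close> are the vertices \<open>a\<close> and \<open>b\<close>, \<open>P j k\<close> is \<open>(j, k)\<close>, and \<open>S k\<close> is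
  the additional vertex \<open>k\<close>.
\<close>

datatype vertex = VA | VB | P nat nat | S nat

text \<open>The \<open>k\<close>-th vertex away from \<open>a\<close> on the \<open>j\<close>-th path of \<open>Y_hat m n\<close>, end points
  included.\<close>

definition path_vertex :: "nat \<Rightarrow> nat \<Rightarrow> nat \<Rightarrow> vertex" where
  "path_vertex n j k = (if k = 0 then VA else if k = n + 1 then VB else P j k)"

definition Y_hat :: "nat \<Rightarrow> nat \<Rightarrow> vertex graph" where
  "Y_hat m n =
     \<lparr>verts = {VA, VB} \<union> {P j k | j k. j \<in> {1..m} \<and> k \<in> {1..n}},
      edges = {{path_vertex n j k, path_vertex n j (k + 1)} | j k. j \<in> {1..m} \<and> k \<in> {0..n}}\<rparr>"

text \<open>For \<open>n = 0\<close> this is \<open>Y_hat m 1\<close>, as required.\<close>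

definition Delta :: "nat \<Rightarrow> nat \<Rightarrow> vertex graph" where
  "Delta m n =
     \<lparr>verts = verts (Y_hat m (n + 1)) \<union> S ` {1..n},
      edges = edges (Y_hat m (n + 1)) \<union>
        {{S k, P j i} | k j i. k \<in> {1..n} \<and> j \<in> {1..m} \<and> i \<in> {k, k + 1}}\<rparr>"


section \<open>Trees for the auxiliary graphs\<close>

text \<open>The tree of the path whose consecutive vertices are listed, worked off from the head
  of the list.  Working from the other end instead changes neither the number of leaves nor
  the sizes of their faces.\<close>

fun path_tree :: "'v list \<Rightarrow> 'v mtree" where
  "path_tree [] = Leaf"
| "path_tree [p] = Free p"
| "path_tree [p, v] = Match p v Leaf"
| "path_tree (p # v # w # xs) = Match p v (path_tree xs)"

text \<open>The vertices \<open>(j, l), \<dots>, (j, i)\<close>, outermost first.\<close>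

definition tendril :: "nat \<Rightarrow> nat \<Rightarrow> nat \<Rightarrow> vertex list" where
  "tendril i l j = map (P j) (rev [i..<l + 1])"

text \<open>The path trees of the \<open>m\<close> tendrils, one below the other, and \<open>t\<close> below the
  remaining nonempty leaf, if any.\<close>

definition tendrils_tree :: "nat \<Rightarrow> nat \<Rightarrow> nat \<Rightarrow> vertex mtree \<Rightarrow> vertex mtree" where
  "tendrils_tree m i l t = foldr (\<lambda>j s. graft (path_tree (tendril i l j)) s) [1..<m + 1] t"

text \<open>The tree of the extended star with centre \<open>VA\<close> and tendrils \<open>P j 1, \<dots>, P j n\<close>;
  it also covers the single vertex \<open>n = 0\<close>.\<close>

definition Y_tree :: "nat \<Rightarrow> nat \<Rightarrow> vertex mtree" where
  "Y_tree m n =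
     (if n mod 3 = 0 then tendrils_tree m 1 n (Free VA)
      else Split VA (tendrils_tree m 1 n Leaf) (tendrils_tree m 2 n Leaf))"

definition Y_hat_tree :: "nat \<Rightarrow> nat \<Rightarrow> vertex mtree" where
  "Y_hat_tree m n = Split VB (Y_tree m n) (Y_tree m (n - 1))"


section \<open>The Comb Algorithm\<close>

text \<open>
  Once \<open>S k\<close> is included and \<open>S 1, \<dots>, S (k - 1)\<close> are excluded, the available part of
  \<open>Delta m n\<close> away from \<open>VA\<close> is a copy of \<open>Delta m (n - (k + 1))\<close> embedded by
  \<open>shift (k + 1)\<close>: the vertex \<open>S (k + 1)\<close> has lost its neighbours \<open>P j (k + 1)\<close> and
  plays the part of \<open>a\<close>.
\<close>

fun shift :: "nat \<Rightarrow> vertex \<Rightarrow> vertex" where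
  "shift i VA = S i"
| "shift i VB = VB"
| "shift i (P j l) = P j (l + i)"
| "shift i (S l) = S (l + i)"

text \<open>
  The fold builds the spine of nodes \<open>\<Sigma>(\<emptyset>, {1, \<dots>, k - 1})\<close>, which ends in the tree of
  \<open>Y_hat m (n + 1)\<close>.  For \<open>n = 0\<close> it is just the tree of \<open>Y_hat m 1\<close>.
\<close>

function comb_tree :: "nat \<Rightarrow> nat \<Rightarrow> vertex mtree" where
  "comb_tree m n =
     foldr
       (\<lambda>k t. Split (S k) t
          (if k = 1 then Free VA
           else if k = n then Free VB
           else graft (Y_tree m (k - 1))
                  (map_mtree (shift (k + 1)) (comb_tree m (n - (k + 1))))))
       [1..<n + 1] (Y_hat_tree m (n + 1))"
  by pat_completeness auto
termination
  by (relation "measure snd") auto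

declare comb_tree.simps [simp del]


subsection \<open>The Comb Algorithm yields matching trees\<close>

text \<open>
  \<open>run N U W t\<close>: starting with available vertices \<open>U\<close> and neighbourhoods \<open>N\<close>, the rules
  recorded in \<open>t\<close> apply, and every leaf \<open>Leaf\<close> has available vertices \<open>W\<close>.
\<close>

fun run :: "('v \<Rightarrow> 'v set) \<Rightarrow> 'v set \<Rightarrow> 'v set \<Rightarrow> 'v mtree \<Rightarrow> bool" where
  "run N U W Leaf \<longleftrightarrow> U = W"
| "run N U W (Free p) \<longleftrightarrow> p \<in> U \<and> N p \<inter> U = {}"
| "run N U W (Match p v t) \<longleftrightarrow> p \<in> U \<and> N p \<inter> U = {v} \<and> run N (U - {v} - N v) W t"
| "run N U W (Split v t\<^sub>0 t\<^sub>1) \<longleftrightarrow>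
     v \<in> U \<and> run N (U - {v}) W t\<^sub>0 \<and> run N (U - {v} - N v) W t\<^sub>1"

lemma run_graft: "run N U W t \<Longrightarrow> run N W X s \<Longrightarrow> run N U X (graft t s)"
  by (induction t arbitrary: U) auto

lemma run_frame:
  assumes "run N U W t" "U \<inter> X = {}" "\<And>u. u \<in> U \<Longrightarrow> N u \<inter> X = {}"
  shows "run N (U \<union> X) (W \<union> X) t"
  using assms
proof (induction t arbitrary: U)
  case (Match p v t)
  then have v: "v \<in> U" by auto
  then have eq: "U \<union> X - {v} - N v = (U - {v} - N v) \<union> X" using Match.prems by blast
  have "run N ((U - {v} - N v) \<union> X) (W \<union> X) t"
    by (rule Match.IH) (use Match.prems in auto)
  moreover have "N p \<inter> (U \<union> X) = {v}" using Match.prems by auto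
  ultimately show ?case using Match.prems eq by auto
next
  case (Split v t0 t1)
  then have v: "v \<in> U" by auto
  then have eq: "U \<union> X - {v} - N v = (U - {v} - N v) \<union> X" "U \<union> X - {v} = (U - {v}) \<union> X"
    using Split.prems by blast+
  have "run N ((U - {v} - N v) \<union> X) (W \<union> X) t1" "run N ((U - {v}) \<union> X) (W \<union> X) t0"
    using Split.prems by (auto intro!: Split.IH)
  then show ?case using v eq by auto
qed auto

lemma run_map:
  assumes "run N U W t" "inj_on f U" "\<And>u. u \<in> U \<Longrightarrow> N' (f u) \<inter> f ` U = f ` (N u \<inter> U)"
  shows "run N' (f ` U) (f ` W) (map_mtree f t)"
  using assms
proof (induction t arbitrary: U)
  case (Match p v t)
  then have v: "v \<in> U" "p \<in> U" and N: "N p \<inter> U = {v}" by auto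
  have eq: "f ` U - {f v} - N' (f v) = f ` (U - {v} - N v)"
    using Match.prems(2) Match.prems(3)[OF v(1)] v(1) by (fastforce simp: inj_on_def)
  have "run N' (f ` (U - {v} - N v)) (f ` W) (map_mtree f t)"
  proof (rule Match.IH)
    fix u assume u: "u \<in> U - {v} - N v"
    then have "N' (f u) \<inter> f ` U = f ` (N u \<inter> U)" using Match.prems(3) by blast
    then show "N' (f u) \<inter> f ` (U - {v} - N v) = f ` (N u \<inter> (U - {v} - N v))"
      using Match.prems(2) by (fastforce simp: inj_on_def)
  qed (use Match.prems in \<open>auto intro: inj_on_subset\<close>)
  then show ?case using eq v Match.prems(3)[OF v(2)] N by auto
next
  case (Split v t0 t1)
  then have v: "v \<in> U" by auto
  have eq: "f ` U - {f v} - N' (f v) = f ` (U - {v} - N v)" "f ` U - {f v} = f ` (U - {v})"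
    using Split.prems(2) Split.prems(3)[OF v] v by (fastforce simp: inj_on_def)+
  have step: "N' (f u) \<inter> f ` X = f ` (N u \<inter> X)" if "u \<in> X" "X \<subseteq> U" for u X
  proof -
    have "N' (f u) \<inter> f ` U = f ` (N u \<inter> U)" using Split.prems(3) that by blast
    then show ?thesis using Split.prems(2) that by (fastforce simp: inj_on_def)
  qed
  have "run N' (f ` (U - {v} - N v)) (f ` W) (map_mtree f t1)"
       "run N' (f ` (U - {v})) (f ` W) (map_mtree f t0)"
    using Split.prems by (intro Split.IH; auto intro: inj_on_subset intro!: step)+
  then show ?case using v eq by auto
qed auto

fun is_path :: "('v \<Rightarrow> 'v set) \<Rightarrow> 'v list \<Rightarrow> bool" where
  "is_path N [] \<longleftrightarrow> True"
| "is_path N (x # xs) \<longleftrightarrow> x \<notin> set xs \<and> N x \<inter> set xs = set (take 1 xs) \<and> is_path N xs"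

lemma run_path_tree:
  assumes "is_path N xs" "set xs \<inter> X = {}" "\<And>x. x \<notin> N x" "\<And>x y. x \<in> N y \<Longrightarrow> y \<in> N x"
    "\<And>x. x \<in> set (if length xs mod 3 = 0 then butlast xs else xs) \<Longrightarrow> N x \<inter> X = {}"
  shows "run N (set xs \<union> X) X (path_tree xs)"
  using assms
proof (induction xs rule: path_tree.induct)
  case (3 p v)
  have X: "N p \<inter> X = {}" "N v \<inter> X = {}"
    using "3.prems"(5)[of p] "3.prems"(5)[of v] by auto
  have "v \<in> N p" using "3.prems"(1) by auto
  then have vp: "v \<in> N p" "p \<in> N v" using "3.prems"(4) by auto
  have "set [p, v] \<union> X - {v} - N v = X" using "3.prems"(2) X vp by auto
  moreover have "N p \<inter> (set [p, v] \<union> X) = {v}" using "3.prems"(3)[of p] X vp by auto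
  ultimately show ?case by simp
next
  case (4 p v w xs)
  have X: "N p \<inter> X = {}" "N v \<inter> X = {}"
    using "4.prems"(5)[of p] "4.prems"(5)[of v] by auto
  have "v \<in> N p" using "4.prems"(1) by auto
  then have vp: "v \<in> N p" "p \<in> N v" using "4.prems"(4) by auto
  have "set (p # v # w # xs) \<union> X - {v} - N v = set xs \<union> X"
    using "4.prems"(1,2) X vp by auto
  moreover have "run N (set xs \<union> X) X (path_tree xs)"
  proof (rule "4.IH")
    fix x assume x: "x \<in> set (if length xs mod 3 = 0 then butlast xs else xs)"
    then have "xs \<noteq> []" by (auto split: if_splits)
    moreover have "length (p # v # w # xs) mod 3 = (length xs + 3) mod 3" by simp
    then have "length (p # v # w # xs) mod 3 = length xs mod 3" by (simp only: mod_add_self2)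
    ultimately show "N x \<inter> X = {}" using x by (intro "4.prems"(5)) (auto split: if_splits)
  qed (use "4.prems" in auto)
  moreover have "N p \<inter> (set (p # v # w # xs) \<union> X) = {v}"
    using "4.prems"(1) "4.prems"(3)[of p] X vp by auto
  ultimately show ?case by simp
qed auto

fun adj :: "nat \<Rightarrow> nat \<Rightarrow> vertex \<Rightarrow> vertex \<Rightarrow> bool" where
  "adj m n VA (P j k) \<longleftrightarrow> j \<in> {1..m} \<and> k = 1"
| "adj m n (P j k) VA \<longleftrightarrow> j \<in> {1..m} \<and> k = 1"
| "adj m n VB (P j k) \<longleftrightarrow> j \<in> {1..m} \<and> k = n + 1"
| "adj m n (P j k) VB \<longleftrightarrow> j \<in> {1..m} \<and> k = n + 1"
| "adj m n (P j k) (P i l) \<longleftrightarrow>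
     j = i \<and> j \<in> {1..m} \<and> k \<in> {1..n + 1} \<and> l \<in> {1..n + 1} \<and> (l = k + 1 \<or> k = l + 1)"
| "adj m n (S k) (P j l) \<longleftrightarrow> k \<in> {1..n} \<and> j \<in> {1..m} \<and> (l = k \<or> l = k + 1)"
| "adj m n (P j l) (S k) \<longleftrightarrow> k \<in> {1..n} \<and> j \<in> {1..m} \<and> (l = k \<or> l = k + 1)"
| "adj m n _ _ \<longleftrightarrow> False"

lemma adj_sym: "adj m n p q \<longleftrightarrow> adj m n q p"
  by (cases p; cases q) auto

lemma path_edge_iff:
  "(\<exists>j k. j \<in> {1..m} \<and> k \<in> {0..n + 1} \<and>
     {p, q} = {path_vertex (n + 1) j k, path_vertex (n + 1) j (k + 1)}) \<longleftrightarrow>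
   adj m n p q \<and> (\<forall>k. p \<noteq> S k \<and> q \<noteq> S k)" (is "?L \<longleftrightarrow> ?R")
proof
  assume ?L
  then obtain j k where jk: "j \<in> {1..m}" "k \<le> n + 1"
    "p = path_vertex (n + 1) j k \<and> q = path_vertex (n + 1) j (k + 1) \<or>
     q = path_vertex (n + 1) j k \<and> p = path_vertex (n + 1) j (k + 1)"
    by (auto simp: doubleton_eq_iff)
  then show ?R by (auto simp: path_vertex_def split: if_splits)
next
  have wit: "\<exists>j k. j \<in> {1..m} \<and> k \<in> {0..n + 1} \<and>
      {p, q} = {path_vertex (n + 1) j k, path_vertex (n + 1) j (k + 1)}"
    if "j \<in> {1..m}" "k \<le> n + 1"
      "{p, q} = {path_vertex (n + 1) j k, path_vertex (n + 1) j (k + 1)}" for j k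
  proof -
    have "k \<in> {0..n + 1}" using that(2) by simp
    then show ?thesis using that(1,3) by blast
  qed
  assume R: ?R
  show ?L
  proof (cases p)
    case VA
    then obtain j where "q = P j 1" "j \<in> {1..m}" using R by (cases q) auto
    then show ?thesis using VA by (intro wit[of j 0]) (auto simp: path_vertex_def)
  next
    case VB
    then obtain j where "q = P j (n + 1)" "j \<in> {1..m}" using R by (cases q) auto
    then show ?thesis using VB by (intro wit[of j "n + 1"]) (auto simp: path_vertex_def)
  next
    case (P j k)
    show ?thesis
    proof (cases q)
      case VA
      then show ?thesis using P R by (intro wit[of j 0]) (auto simp: path_vertex_def)
    next
      case VB
      then show ?thesis using P R by (intro wit[of j "n + 1"]) (auto simp: path_vertex_def)
    next
      case (P i l)
      then show ?thesis using \<open>p = P j k\<close> R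
        by (intro wit[of j "min k l"]) (auto simp: path_vertex_def)
    qed (use R in auto)
  qed (use R in auto)
qed

lemma edge_Delta_iff: "{p, q} \<in> edges (Delta m n) \<longleftrightarrow> adj m n p q"
proof -
  have "{p, q} \<in> {{S k, P j i} | k j i. k \<in> {1..n} \<and> j \<in> {1..m} \<and> i \<in> {k, k + 1}} \<longleftrightarrow>
      adj m n p q \<and> ((\<exists>k. p = S k) \<or> (\<exists>k. q = S k))"
    by (cases p; cases q) (auto simp: doubleton_eq_iff)
  moreover have "{p, q} \<in> edges (Y_hat m (n + 1)) \<longleftrightarrow>
      adj m n p q \<and> (\<forall>k. p \<noteq> S k \<and> q \<noteq> S k)"
    unfolding path_edge_iff[symmetric] by (auto simp: Y_hat_def)
  ultimately show ?thesis unfolding Delta_def by auto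
qed

lemma nbrs_Delta: "nbrs (Delta m n) p = {q. adj m n p q}"
  by (simp add: nbrs_def edge_Delta_iff)

lemma adj_irrefl: "\<not> adj m n p p"
  by (cases p) auto

lemma verts_Delta:
  "verts (Delta m n) =
     {VA, VB} \<union> {P j k | j k. j \<in> {1..m} \<and> k \<in> {1..n + 1}} \<union> S ` {1..n}"
  by (simp add: Delta_def Y_hat_def)

lemma adj_verts: "adj m n p q \<Longrightarrow> q \<in> verts (Delta m n)"
  by (cases p; cases q) (auto simp: verts_Delta)

lemma simple_graph_Delta: "simple_graph (Delta m n)"
  unfolding simple_graph_def
proof (intro conjI ballI)
  have "{P j k | j k. j \<in> {1..m} \<and> k \<in> {1..n + 1}} = (\<lambda>(j, k). P j k) ` ({1..m} \<times> {1..n + 1})"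
    by auto
  then show "finite (verts (Delta m n))" by (simp add: verts_Delta)
  fix e assume e: "e \<in> edges (Delta m n)"
  then obtain p q where pq: "e = {p, q}" by (auto simp: Delta_def Y_hat_def)
  then have "adj m n p q" using e edge_Delta_iff by blast
  then show "e \<subseteq> verts (Delta m n)" "card e = 2"
    using adj_verts adj_sym adj_irrefl[of m n p] unfolding pq by (auto simp: card_2_iff)
qed

abbreviation nb :: "nat \<Rightarrow> nat \<Rightarrow> vertex \<Rightarrow> vertex set" where
  "nb m n p \<equiv> {q. adj m n p q}"

definition tendrils :: "nat set \<Rightarrow> nat \<Rightarrow> nat \<Rightarrow> vertex set" where
  "tendrils J i l = {P j k | j k. j \<in> J \<and> k \<in> {i..l}}"

lemma set_tendril: "set (tendril i l j) = tendrils {j} i l"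
  by (auto simp: tendril_def tendrils_def)

lemma is_path_tendril:
  assumes "j \<in> {1..m}" "1 \<le> i" "l \<le> n + 1"
  shows "is_path (nb m n) (tendril i l j)"
  using assms(3)
proof (induction l)
  case 0
  then show ?case using assms by (simp add: tendril_def)
next
  case (Suc l)
  then have IH: "is_path (nb m n) (tendril i l j)" by simp
  show ?case
  proof (cases "i \<le> Suc l")
    case True
    then have Cons: "tendril i (Suc l) j = P j (Suc l) # tendril i l j"
      by (simp add: tendril_def)
    have "set (take 1 (tendril i l j)) = (if i \<le> l then {P j l} else {})"
      by (auto simp: tendril_def)
    then show ?thesis unfolding Cons using IH assms Suc.prems True
      by (auto simp: set_tendril tendrils_def)
  next
    case False
    then show ?thesis by (simp add: tendril_def)
  qed
qed

lemma run_tendrils_tree: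
  assumes "1 \<le> i" "l \<le> n + 1" and t: "run (nb m n) X W t"
    and disj: "X \<inter> tendrils {1..m} i l = {}"
    and X: "\<And>j k. j \<in> {1..m} \<Longrightarrow> k \<in> {i..l} \<Longrightarrow> k \<noteq> i \<or> (l + 1 - i) mod 3 \<noteq> 0 \<Longrightarrow>
             nb m n (P j k) \<inter> X = {}"
  shows "run (nb m n) (tendrils {1..m} i l \<union> X) W (tendrils_tree m i l t)"
proof -
  have "run (nb m n) (tendrils (set js) i l \<union> X) W
      (foldr (\<lambda>j s. graft (path_tree (tendril i l j)) s) js t)"
    if "distinct js" "set js \<subseteq> {1..m}" for js
    using that
  proof (induction js)
    case Nil
    then show ?case using t by (simp add: tendrils_def)
  next
    case (Cons j js)
    then have j: "j \<in> {1..m}" by auto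
    let ?X = "tendrils (set js) i l \<union> X"
    have last: "x \<in> set (butlast (tendril i l j)) \<Longrightarrow> \<exists>k\<in>{i<..l}. x = P j k" for x
    proof -
      assume x: "x \<in> set (butlast (tendril i l j))"
      then have "i \<le> l" by (cases "i \<le> l") (auto simp: tendril_def)
      then have "butlast (tendril i l j) = map (P j) (rev [Suc i..<l + 1])"
        by (simp add: tendril_def map_butlast[symmetric] upt_conv_Cons del: upt_Suc)
      then show ?thesis using x by auto
    qed
    have "run (nb m n) (set (tendril i l j) \<union> ?X) ?X (path_tree (tendril i l j))"
    proof (rule run_path_tree)
      show "is_path (nb m n) (tendril i l j)" using j assms(1,2) by (rule is_path_tendril)
      show "set (tendril i l j) \<inter> ?X = {}"
        using Cons.prems disj j by (auto simp: set_tendril tendrils_def)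
      fix x assume x: "x \<in> set (if length (tendril i l j) mod 3 = 0
                               then butlast (tendril i l j) else tendril i l j)"
      have len: "length (tendril i l j) = l + 1 - i" by (simp add: tendril_def del: upt_Suc)
      obtain k where k: "x = P j k" "k \<in> {i..l}" "k \<noteq> i \<or> (l + 1 - i) mod 3 \<noteq> 0"
      proof (cases "(l + 1 - i) mod 3 = 0")
        case True
        then show ?thesis using x last len that by (metis greaterThanAtMost_iff atLeastAtMost_iff less_imp_le less_irrefl)
      next
        case False
        then show ?thesis using x len that by (auto simp: set_tendril tendrils_def)
      qed
      have "nb m n x \<inter> X = {}" using X[OF j k(2,3)] k(1) by simp
      moreover have "nb m n x \<inter> tendrils (set js) i l = {}"
        using Cons.prems k(1) by (auto simp: tendrils_def)
      ultimately show "nb m n x \<inter> ?X = {}" by blast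
    qed (auto simp: adj_irrefl adj_sym)
    moreover have "set (tendril i l j) \<union> ?X = tendrils (set (j # js)) i l \<union> X"
      by (auto simp: set_tendril tendrils_def)
    ultimately show ?case using Cons run_graft by fastforce
  qed
  from this[of "[1..<m + 1]"] show ?thesis
    by (simp add: tendrils_tree_def atLeastLessThanSuc_atLeastAtMost del: upt_Suc)
qed

lemma run_Y_tree:
  assumes "l \<le> n + 1"
  shows "run (nb m n) (insert VA (tendrils {1..m} 1 l)) {} (Y_tree m l)"
proof (cases "l mod 3 = 0")
  case True
  have "run (nb m n) (tendrils {1..m} 1 l \<union> {VA}) {} (tendrils_tree m 1 l (Free VA))"
    using assms True by (intro run_tendrils_tree) (auto simp: tendrils_def)
  then show ?thesis using True by (simp add: Y_tree_def)
next
  case False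
  then have "l \<noteq> 0" by (auto intro: ccontr)
  then have *: "insert VA (tendrils {1..m} 1 l) - {VA} = tendrils {1..m} 1 l"
    "tendrils {1..m} 1 l - nb m n VA = tendrils {1..m} 2 l"
    by (auto simp: tendrils_def)
  have "run (nb m n) (tendrils {1..m} i l \<union> {}) {} (tendrils_tree m i l Leaf)"
    if "1 \<le> i" for i
    using assms that by (intro run_tendrils_tree) auto
  from this[of 1] this[of 2]
  have "run (nb m n) (insert VA (tendrils {1..m} 1 l)) {}
      (Split VA (tendrils_tree m 1 l Leaf) (tendrils_tree m 2 l Leaf))"
    unfolding run.simps * by simp
  then show ?thesis using False by (simp add: Y_tree_def)
qed

lemma run_Y_hat_tree:
  "run (nb m n) ({VA, VB} \<union> tendrils {1..m} 1 (n + 1)) {} (Y_hat_tree m (n + 1))"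
proof -
  have "({VA, VB} \<union> tendrils {1..m} 1 (n + 1)) - {VB} = insert VA (tendrils {1..m} 1 (n + 1))"
    "({VA, VB} \<union> tendrils {1..m} 1 (n + 1)) - {VB} - nb m n VB = insert VA (tendrils {1..m} 1 n)"
    by (auto simp: tendrils_def)
  then show ?thesis
    using run_Y_tree[of "n + 1" n m] run_Y_tree[of n n m] by (simp add: Y_hat_tree_def)
qed

lemma shift_embeds:
  assumes "u \<in> verts (Delta m n)" "v \<in> verts (Delta m n)" "i \<ge> 1"
  shows "adj m (n + i) (shift i u) (shift i v) \<longleftrightarrow> adj m n u v"
  using assms by (cases u; cases v) (auto simp: verts_Delta)

lemma shift_inj: "i \<ge> 1 \<Longrightarrow> inj_on (shift i) (verts (Delta m n))"
  unfolding inj_on_def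
proof (intro ballI impI)
  fix u v assume "i \<ge> 1" "u \<in> verts (Delta m n)" "v \<in> verts (Delta m n)" "shift i u = shift i v"
  then show "u = v" by (cases u; cases v) (auto simp: verts_Delta)
qed

lemma run_comb_tree:
  assumes "m \<ge> 1"
  shows "run (nb m n) (verts (Delta m n)) {} (comb_tree m n)"
proof (induction n rule: less_induct)
  case (less n)
  let ?N = "nb m n"
  define br where "br = (\<lambda>k. if k = 1 then Free VA
           else if k = n then Free VB
           else graft (Y_tree m (k - 1)) (map_mtree (shift (k + 1)) (comb_tree m (n - (k + 1)))))"
  define U where "U = (\<lambda>k. {VA, VB} \<union> tendrils {1..m} 1 (n + 1) \<union> S ` {k..n})"
  have br: "run ?N (U k - {S k} - ?N (S k)) {} (br k)" if k: "1 \<le> k" "k \<le> n" for k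
  proof (cases "k = 1 \<or> k = n")
    case True
    then show ?thesis using k by (auto simp: br_def U_def tendrils_def)
  next
    case False
    let ?i = "k + 1"
    let ?V = "verts (Delta m (n - ?i))"
    have n: "n = n - ?i + ?i" using False k by auto
    have im: "shift ?i ` ?V = {S ?i, VB} \<union> tendrils {1..m} (k + 2) (n + 1) \<union> S ` {k + 2..n}"
      (is "_ = ?D")
    proof (intro equalityI subsetI)
      fix x assume "x \<in> ?D"
      then consider "x = S ?i" | "x = VB" | j l where "x = P j l" "j \<in> {1..m}" "l \<in> {k + 2..n + 1}"
        | l where "x = S l" "l \<in> {k + 2..n}" by (auto simp: tendrils_def)
      then show "x \<in> shift ?i ` ?V"
      proof cases
        case 1
        then show ?thesis by (intro image_eqI[of _ _ VA]) (auto simp: verts_Delta)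
      next
        case 2
        then show ?thesis by (intro image_eqI[of _ _ VB]) (auto simp: verts_Delta)
      next
        case (3 j l)
        then show ?thesis by (intro image_eqI[of _ _ "P j (l - ?i)"]) (auto simp: verts_Delta)
      next
        case (4 l)
        then show ?thesis
          by (intro image_eqI[of _ _ "S (l - ?i)"]) (auto simp: verts_Delta intro!: imageI)
      qed
    qed (use False k in \<open>auto simp: verts_Delta tendrils_def\<close>)
    have U: "U k - {S k} - ?N (S k) = insert VA (tendrils {1..m} 1 (k - 1)) \<union> ?D"
      using k False by (auto simp: U_def tendrils_def)
    have "run ?N (insert VA (tendrils {1..m} 1 (k - 1)) \<union> ?D) ({} \<union> ?D) (Y_tree m (k - 1))"
      by (intro run_frame run_Y_tree) (use k in \<open>auto simp: tendrils_def\<close>)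
    moreover have "run ?N (shift ?i ` ?V) (shift ?i ` {})
        (map_mtree (shift ?i) (comb_tree m (n - ?i)))"
    proof (rule run_map)
      show "run (nb m (n - ?i)) ?V {} (comb_tree m (n - ?i))" using k by (intro less.IH) auto
      show "inj_on (shift ?i) ?V" by (intro shift_inj) simp
      fix u assume u: "u \<in> ?V"
      have "adj m n (shift ?i u) (shift ?i v) \<longleftrightarrow> adj m (n - ?i) u v" if "v \<in> ?V" for v
        using shift_embeds[OF u that, of ?i] n by simp
      then show "?N (shift ?i u) \<inter> shift ?i ` ?V = shift ?i ` (nb m (n - ?i) u \<inter> ?V)" by auto
    qed
    ultimately have "run ?N (insert VA (tendrils {1..m} 1 (k - 1)) \<union> ?D) {}
        (graft (Y_tree m (k - 1)) (map_mtree (shift ?i) (comb_tree m (n - ?i))))"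
      using im by (auto intro: run_graft)
    then show ?thesis using False U by (simp add: br_def)
  qed
  have "run ?N (U k) {} (foldr (\<lambda>k t. Split (S k) t (br k)) [k..<n + 1] (Y_hat_tree m (n + 1)))"
    if "1 \<le> k" "k \<le> n + 1" for k
    using that(2,1)
  proof (induction k rule: inc_induct)
    case base
    then show ?case using run_Y_hat_tree[of m n] by (simp add: U_def)
  next
    case (step k)
    have "U k - {S k} = U (Suc k)" "S k \<in> U k"
      using step.hyps by (auto simp: U_def tendrils_def)
    moreover have "[k..<n + 1] = k # [Suc k..<n + 1]"
      using step.hyps by (simp add: upt_conv_Cons)
    ultimately show ?case using step br[of k] by simp
  qed
  from this[of 1] have "run ?N (U 1) {} (comb_tree m n)"
    by (simp add: comb_tree.simps[of m n] br_def cong: foldr_cong)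
  moreover have "U 1 = verts (Delta m n)" by (auto simp: U_def verts_Delta tendrils_def)
  ultimately show ?case by simp
qed

lemma run_imp_matching_tree_at:
  assumes "simple_graph G"
    and "run (nbrs G) (verts G - (A \<union> B)) {} t"
    and "A \<in> Ind G" "A \<inter> B = {}" "\<And>x. x \<in> A \<Longrightarrow> nbrs G x \<subseteq> B"
  shows "matching_tree_at G A B t"
  using assms(2-)
proof (induction t arbitrary: A B)
  have fin: "finite (Sigma_node G A B)" for A B
    using assms(1) by (auto simp: simple_graph_def Sigma_node_def Ind_def
        intro: finite_subset[of _ "Pow (verts G)"])
  have nv: "nbrs G x \<subseteq> verts G" and irr: "x \<notin> nbrs G x" for x
    using assms(1) by (fastforce simp: simple_graph_def nbrs_def)+
  have sym: "x \<in> nbrs G y \<longleftrightarrow> y \<in> nbrs G x" for x y by (simp add: nbrs_def insert_commute)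
  have ins: "insert v A \<in> Ind G"
    if A: "A \<in> Ind G" "v \<in> verts G - (A \<union> B)" "\<And>x. x \<in> A \<Longrightarrow> nbrs G x \<subseteq> B" for v A B
  proof -
    have "\<not> e \<subseteq> insert v A" if e: "e \<in> edges G" for e
    proof
      assume sub: "e \<subseteq> insert v A"
      obtain x y where xy: "e = {x, y}" "x \<noteq> y"
        using e assms(1) by (auto simp: simple_graph_def card_2_iff)
      then have nb: "y \<in> nbrs G x" "x \<in> nbrs G y" using e by (auto simp: nbrs_def insert_commute)
      have "\<not> e \<subseteq> A" using A(1) e by (auto simp: Ind_def)
      then consider "x = v" "y \<in> A" | "y = v" "x \<in> A" using sub xy by blast
      then show False using nb A(2,3) by cases blast+
    qed
    then show ?thesis using that by (auto simp: Ind_def)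
  qed
  have two: "2 \<le> card (Sigma_node G A B)"
    if "A \<in> Ind G" "A \<inter> B = {}" "v \<in> verts G - (A \<union> B)" "\<And>x. x \<in> A \<Longrightarrow> nbrs G x \<subseteq> B" for v A B
  proof -
    have "{A, insert v A} \<subseteq> Sigma_node G A B"
      using that ins[OF that(1,3,4)] by (auto simp: Sigma_node_def)
    moreover have "card {A, insert v A} = 2" using that by (auto simp: card_2_iff)
    ultimately show ?thesis using fin card_mono by metis
  qed
  have inc: "matching_tree_at G (insert v A) (B \<union> nbrs G v) t"
    if "\<And>A B. run (nbrs G) (verts G - (A \<union> B)) {} t \<Longrightarrow> A \<in> Ind G \<Longrightarrow> A \<inter> B = {} \<Longrightarrow>
          (\<And>x. x \<in> A \<Longrightarrow> nbrs G x \<subseteq> B) \<Longrightarrow> matching_tree_at G A B t"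
      "run (nbrs G) (verts G - (A \<union> B) - {v} - nbrs G v) {} t"
      "A \<in> Ind G" "A \<inter> B = {}" "v \<in> verts G - (A \<union> B)" "\<And>x. x \<in> A \<Longrightarrow> nbrs G x \<subseteq> B"
    for v A B t
  proof (rule that(1))
    have "verts G - (insert v A \<union> (B \<union> nbrs G v)) = verts G - (A \<union> B) - {v} - nbrs G v" by auto
    then show "run (nbrs G) (verts G - (insert v A \<union> (B \<union> nbrs G v))) {} t" using that by simp
    show "insert v A \<in> Ind G" using ins that by blast
    show "insert v A \<inter> (B \<union> nbrs G v) = {}" using that irr sym by blast
    show "nbrs G x \<subseteq> B \<union> nbrs G v" if "x \<in> insert v A" for x
      using that \<open>\<And>x. x \<in> A \<Longrightarrow> nbrs G x \<subseteq> B\<close> by blast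
  qed
  {
    case Leaf
    then have "Sigma_node G A B \<subseteq> {A}" by (auto simp: Sigma_node_def Ind_def)
    then have "card (Sigma_node G A B) \<le> card {A}" by (intro card_mono) auto
    then show ?case by simp
  next
    case (Free p)
    then show ?case using two[of A B p] nv[of p] by auto
  next
    case (Match p v t)
    then have p: "p \<in> verts G - (A \<union> B)" "nbrs G p - (A \<union> B) = {v}"
      and v: "v \<in> verts G - (A \<union> B)" using nv[of p] by auto
    have "matching_tree_at G (insert v A) (B \<union> nbrs G v) t"
      by (rule inc[OF Match.IH]) (use Match.prems v in simp_all)
    moreover have "2 \<le> card (Sigma_node G A B)" using two[OF Match.prems(2,3) p(1) Match.prems(4)] .
    ultimately show ?case using p by simp
  next
    case (Split v t0 t1)
    have "matching_tree_at G A (insert v B) t0"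
    proof (rule Split.IH)
      have "verts G - (A \<union> insert v B) = verts G - (A \<union> B) - {v}" by auto
      then show "run (nbrs G) (verts G - (A \<union> insert v B)) {} t0" using Split.prems by simp
    qed (use Split.prems in auto)
    moreover have v: "v \<in> verts G - (A \<union> B)" using Split.prems(1) by simp
    moreover have "matching_tree_at G (insert v A) (B \<union> nbrs G v) t1"
      by (rule inc[OF Split.IH(2)]) (use Split.prems v in simp_all)
    moreover have "2 \<le> card (Sigma_node G A B)" using two[OF Split.prems(2,3) v Split.prems(4)] .
    ultimately show ?case by simp
  }
qed

theorem matching_tree_comb_tree:
  assumes "m \<ge> 1"
  shows "matching_tree (Delta m n) (comb_tree m n)"
  unfolding matching_tree_def
proof (rule run_imp_matching_tree_at)
  show "run (nbrs (Delta m n)) (verts (Delta m n) - ({} \<union> {})) {} (comb_tree m n)"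
    using run_comb_tree[OF assms] by (simp add: nbrs_Delta[abs_def])
  show "{} \<in> Ind (Delta m n)"
    using simple_graph_Delta[of m n] by (auto simp: Ind_def simple_graph_def)
qed (auto simp: simple_graph_Delta)


section \<open>Cell numbers\<close>

text \<open>The number of \<open>d\<close>-cells of \<open>X m n\<close>.  For \<open>n \<ge> 1\<close> there is one cell for every
  critical cell and the base \<open>0\<close>-cell in addition; \<open>X m 0\<close> is the \<open>0\<close>-sphere with two
  \<open>0\<close>-cells.\<close>

definition num_cells_X :: "nat \<Rightarrow> nat \<Rightarrow> int \<Rightarrow> nat" where
  "num_cells_X m n d =
     (if n = 0 then (if d = 0 then 2 else 0)
      else card {A \<in> critical_cells (Delta m n) (comb_tree m n). face_dim A = d}
           + (if d = 0 then 1 else 0))"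

definition C_num :: "nat \<Rightarrow> nat \<Rightarrow> int \<Rightarrow> nat" where
  "C_num m n d =
     (if d < 0 then 0 else if d = 0 then num_cells_X m n 0 - 1 else num_cells_X m n d)"

definition d_max :: "nat \<Rightarrow> nat \<Rightarrow> int" where
  "d_max m n =
     (if m = 2 then \<lfloor>(3 * real n + 2) / 4\<rfloor>
      else int n + 1 + (int m - 3) * \<lfloor>(real n + 2) / 3\<rfloor>)"

end

theory Submission
  imports Defs
begin

text \<open>
  A critical cell has at most as many vertices as there are inclusions on the branch leading
  to its leaf, and these numbers can be read off the trees.  The tree of a path on \<open>l\<close>
  vertices contributes \<open>\<lceil>l / 3\<rceil>\<close> inclusions unless \<open>l \<equiv> 1 (mod 3)\<close>, when the free vertex
  leaves no leaf; so the tree of \<open>Y m n\<close> has no leaf for \<open>n \<equiv> 0 (mod 3)\<close>, and only leaves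
  with \<open>m q + 1\<close> or \<open>m (q + 1)\<close> inclusions for \<open>n = 3 q + 1\<close> or \<open>n = 3 q + 2\<close>.
  With these values, \<open>d_max m n + 1\<close> satisfies the recursive inequality of the Comb
  Algorithm, in which the branch of the vertex \<open>k\<close> contributes one plus a leaf of
  \<open>Y m (k - 1)\<close> plus a leaf for \<open>n - (k + 1)\<close>.
\<close>

text \<open>The sizes depend on the tree alone. Whether \<open>\<Sigma>(A, B)\<close> is empty at a
  leaf is ignored, since only an upper bound is wanted.\<close>

fun leaf_sizes :: "'v mtree \<Rightarrow> nat set" where
  "leaf_sizes Leaf = {0}"
| "leaf_sizes (Free p) = {}"
| "leaf_sizes (Match p v t) = Suc ` leaf_sizes t"
| "leaf_sizes (Split v t\<^sub>0 t\<^sub>1) = leaf_sizes t\<^sub>0 \<union> Suc ` leaf_sizes t\<^sub>1"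

lemma card_final_leaves:
  assumes "(A', B') \<in> final_leaves G A B t"
  shows "\<exists>s\<in>leaf_sizes t. card A' \<le> card A + s"
  using assms
proof (induction t arbitrary: A B)
  case (Match p v t)
  then obtain s where "s \<in> leaf_sizes t" "card A' \<le> card (insert v A) + s" by fastforce
  \<comment> \<open>The cardinality grows by at most one even if \<open>v\<close> already lies in
    \<open>A\<close>; hence only an inequality is claimed.\<close>
  then show ?case using card_insert_le_m1[of "Suc (card A)" A v]
    by (intro bexI[of _ "Suc s"]) auto
next
  case (Split v t0 t1)
  from Split.prems consider "(A', B') \<in> final_leaves G A (insert v B) t0"
    | "(A', B') \<in> final_leaves G (insert v A) (B \<union> nbrs G v) t1" by auto
  then show ?case
  proof cases
    case 1
    then show ?thesis using Split.IH(1) by fastforce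
  next
    case 2
    then obtain s where "s \<in> leaf_sizes t1" "card A' \<le> card (insert v A) + s"
      using Split.IH(2) by blast
    then show ?thesis using card_insert_le_m1[of "Suc (card A)" A v]
      by (intro bexI[of _ "Suc s"]) auto
  qed
qed auto

lemma leaf_sizes_graft:
  assumes "s \<in> leaf_sizes (graft t u)"
  shows "\<exists>x\<in>leaf_sizes t. \<exists>y\<in>leaf_sizes u. s = x + y"
  using assms
proof (induction t arbitrary: s)
  case (Match p v t)
  then obtain s' where "s' \<in> leaf_sizes (graft t u)" "s = Suc s'" by auto
  then show ?case using Match.IH by fastforce
next
  case (Split v t0 t1)
  from Split.prems consider "s \<in> leaf_sizes (graft t0 u)"
    | s' where "s' \<in> leaf_sizes (graft t1 u)" "s = Suc s'" by auto
  then show ?case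
  proof cases
    case 1
    then show ?thesis using Split.IH(1) by fastforce
  next
    case 2
    then obtain x y where "x \<in> leaf_sizes t1" "y \<in> leaf_sizes u" "s' = x + y"
      using Split.IH(2) by blast
    then show ?thesis using 2 by (intro bexI[of _ "Suc x"] bexI[of _ y]) auto
  qed
qed auto

lemma leaf_sizes_map [simp]: "leaf_sizes (map_mtree f t) = leaf_sizes t"
  by (induction t) auto

text \<open>Each use of rule (2) with at least three vertices left removes three of them; a
  remainder of two costs one more inclusion, a remainder of one ends in a free vertex. In the
  surviving residues the quotient is the ceiling of a third of the length.\<close>

lemma leaf_sizes_path_tree:
  "leaf_sizes (path_tree xs) =
     (if length xs mod 3 = 1 then {} else {(length xs + 1) div 3})"
proof (induction xs rule: path_tree.induct)
  case (4 p v w xs)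
  have "length (p # v # w # xs) mod 3 = length xs mod 3"
    "(length (p # v # w # xs) + 1) div 3 = Suc ((length xs + 1) div 3)"
    unfolding list.size by presburger+
  then show ?case using 4 by simp
qed auto

lemma leaf_sizes_tendrils_tree:
  assumes "s \<in> leaf_sizes (tendrils_tree m i l t)" "m \<ge> 1"
  shows "(l + 1 - i) mod 3 \<noteq> 1 \<and> (\<exists>y\<in>leaf_sizes t. s = m * ((l + 1 - i + 1) div 3) + y)"
proof -
  have len: "length (tendril i l j) = l + 1 - i" for j by (simp add: tendril_def del: upt_Suc)
  \<comment> \<open>Without any tendril the residue is unconstrained, hence the guard;
    \<open>m \<ge> 1\<close> discharges it.\<close>
  have "(js \<noteq> [] \<longrightarrow> (l + 1 - i) mod 3 \<noteq> 1) \<and>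
      (\<exists>y\<in>leaf_sizes t. s = length js * ((l + 1 - i + 1) div 3) + y)"
    if "s \<in> leaf_sizes (foldr (\<lambda>j s. graft (path_tree (tendril i l j)) s) js t)" for js s
    using that
  proof (induction js arbitrary: s)
    case (Cons j js)
    then obtain x y where xy: "x \<in> leaf_sizes (path_tree (tendril i l j))" "s = x + y"
      "y \<in> leaf_sizes (foldr (\<lambda>j s. graft (path_tree (tendril i l j)) s) js t)"
      using leaf_sizes_graft by fastforce
    from xy(1) have "(l + 1 - i) mod 3 \<noteq> 1" "x = (l + 1 - i + 1) div 3"
      by (simp_all add: leaf_sizes_path_tree len split: if_splits)
    then show ?case using Cons.IH[OF xy(3)] xy(2) by auto
  qed simp
  from this[of s "[1..<m + 1]"] show ?thesis
    using assms by (auto simp: tendrils_tree_def simp del: upt_Suc)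
qed

text \<open>Excluding the centre leaves tendrils with \<open>n\<close> vertices, including it
  tendrils with \<open>n - 1\<close>. Tendrils of residue 1 have no leaf, so exactly one of the two
  branches survives when 3 does not divide \<open>n\<close>.\<close>

lemma leaf_sizes_Y_tree:
  assumes "s \<in> leaf_sizes (Y_tree m n)" "m \<ge> 1"
  obtains q where "n = 3 * q + 1" "s = m * q + 1" | q where "n = 3 * q + 2" "s = m * (q + 1)"
proof -
  define q where "q = n div 3"
  consider "n = 3 * q" | "n = 3 * q + 1" | "n = 3 * q + 2"
    unfolding q_def by linarith
  then show ?thesis
  proof cases
    case 1
    then show ?thesis using assms leaf_sizes_tendrils_tree[of s m 1 n "Free VA"]
      by (auto simp: Y_tree_def)
  next
    case 2
    then show ?thesis
      using assms leaf_sizes_tendrils_tree[of s m 1 n Leaf]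
        leaf_sizes_tendrils_tree[of "s - 1" m 2 n Leaf] that(1)[of q]
      by (auto simp: Y_tree_def)
  next
    case 3
    have "Suc (Suc (3 * q)) mod 3 = 2" by presburger
    then show ?thesis
      using 3 assms leaf_sizes_tendrils_tree[of s m 1 n Leaf]
        leaf_sizes_tendrils_tree[of "s - 1" m 2 n Leaf] that(2)[of q]
      by (auto simp: Y_tree_def)
  qed
qed

text \<open>The spine only excludes and costs nothing, the branches \<open>k = 1\<close> and
  \<open>k = n\<close> end in free vertices, and \<open>shift\<close> merely renames
  vertices.\<close>

lemma leaf_sizes_comb_tree:
  assumes "s \<in> leaf_sizes (comb_tree m n)"
  obtains "s \<in> leaf_sizes (Y_hat_tree m (n + 1))"
    | k x y where "2 \<le> k" "k < n" "x \<in> leaf_sizes (Y_tree m (k - 1))"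
        "y \<in> leaf_sizes (comb_tree m (n - (k + 1)))" "s = 1 + x + y"
proof -
  have "leaf_sizes (foldr (\<lambda>k t. Split (S k) t (f k)) ks t) =
      leaf_sizes t \<union> (\<Union>k\<in>set ks. Suc ` leaf_sizes (f k))" for f ks and t :: "vertex mtree"
    by (induction ks) auto
  then have "s \<in> leaf_sizes (Y_hat_tree m (n + 1)) \<or>
      (\<exists>k\<in>{1..n}. s \<in> Suc ` leaf_sizes (if k = 1 then Free VA else if k = n then Free VB
         else graft (Y_tree m (k - 1)) (map_mtree (shift (k + 1)) (comb_tree m (n - (k + 1))))))"
    using assms unfolding comb_tree.simps[of m n]
    by (auto simp: atLeastLessThanSuc_atLeastAtMost simp del: upt_Suc)
  then show ?thesis
  proof
    assume "s \<in> leaf_sizes (Y_hat_tree m (n + 1))"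
    then show ?thesis by (rule that(1))
  next
    assume "\<exists>k\<in>{1..n}. s \<in> Suc ` leaf_sizes (if k = 1 then Free VA else if k = n then Free VB
       else graft (Y_tree m (k - 1)) (map_mtree (shift (k + 1)) (comb_tree m (n - (k + 1)))))"
    then obtain k where k: "k \<in> {1..n}" "k \<noteq> 1" "k \<noteq> n"
      "s \<in> Suc ` leaf_sizes
         (graft (Y_tree m (k - 1)) (map_mtree (shift (k + 1)) (comb_tree m (n - (k + 1)))))"
      by (auto split: if_splits)
    then obtain x y where "x \<in> leaf_sizes (Y_tree m (k - 1))"
      "y \<in> leaf_sizes (comb_tree m (n - (k + 1)))" "s = 1 + x + y"
      using leaf_sizes_graft by fastforce
    then show ?thesis using that(2)[of k] k(1-3) by simp
  qed
qed

text \<open>Excluding \<open>VB\<close> leaves a star with tendrils of length \<open>n + 1\<close>,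
  including it one with length \<open>n\<close>. Both have leaves only if \<open>n + 1\<close> is 2
  mod 3, hence the disjunction there.\<close>

lemma leaf_sizes_Y_hat_tree:
  assumes "s \<in> leaf_sizes (Y_hat_tree m (n + 1))" "m \<ge> 1"
  obtains q where "n + 1 = 3 * q" "s = m * q + 1"
    | q where "n + 1 = 3 * q + 1" "s = m * q + 1"
    | q where "n + 1 = 3 * q + 2" "s = m * (q + 1) \<or> s = m * q + 2"
proof -
  from assms consider "s \<in> leaf_sizes (Y_tree m (n + 1))"
    | x where "x \<in> leaf_sizes (Y_tree m n)" "s = Suc x"
    by (auto simp: Y_hat_tree_def)
  then show ?thesis
  proof cases
    case 1
    then show ?thesis by (rule leaf_sizes_Y_tree[OF _ assms(2)]) (use that in auto)
  next
    case 2
    from 2(1) assms(2) show ?thesis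
    proof (rule leaf_sizes_Y_tree)
      fix q assume "n = 3 * q + 1" "x = m * q + 1"
      then show ?thesis using 2 that(3)[of q] by simp
    next
      fix q assume "n = 3 * q + 2" "x = m * (q + 1)"
      then show ?thesis using 2 that(1)[of "q + 1"] by simp
    qed
  qed
qed

lemma leaf_sizes_comb_tree_2:
  assumes "s \<in> leaf_sizes (comb_tree 2 n)"
  shows "4 * s \<le> 3 * n + 6"
  using assms
proof (induction n arbitrary: s rule: less_induct)
  case (less n)
  from less.prems show ?case
  proof (rule leaf_sizes_comb_tree)
    assume "s \<in> leaf_sizes (Y_hat_tree 2 (n + 1))"
    then show ?thesis by (rule leaf_sizes_Y_hat_tree) auto
  next
    fix k x y
    assume k: "2 \<le> k" "k < n" "x \<in> leaf_sizes (Y_tree 2 (k - 1))"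
      "y \<in> leaf_sizes (comb_tree 2 (n - (k + 1)))" "s = 1 + x + y"
    have "4 * y \<le> 3 * (n - (k + 1)) + 6" using k by (intro less.IH) auto
    \<comment> \<open>Equality holds at \<open>k = 3\<close>, \<open>x = 2\<close>: three inclusions
      use up four units of \<open>n\<close>, which explains the slope 3/4.\<close>
    moreover have "4 * (1 + x) \<le> 3 * (k + 1)"
      using k(3) by (rule leaf_sizes_Y_tree) (use k(1) in auto)
    ultimately show ?thesis using k(2,5) by simp
  qed
qed

text \<open>With \<open>m = c + 3\<close> the coefficient \<open>m - 3\<close> in
  \<open>d_max\<close> is a natural number, so multiplying by it preserves inequalities.\<close>

lemma leaf_sizes_comb_tree_ge_3:
  assumes "s \<in> leaf_sizes (comb_tree (c + 3) n)"
  shows "s \<le> n + 2 + c * ((n + 2) div 3)"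
  using assms
proof (induction n arbitrary: s rule: less_induct)
  case (less n)
  from less.prems show ?case
  proof (rule leaf_sizes_comb_tree)
    assume "s \<in> leaf_sizes (Y_hat_tree (c + 3) (n + 1))"
    then show ?thesis
    proof (rule leaf_sizes_Y_hat_tree)
      fix q assume "n + 1 = 3 * q" "s = (c + 3) * q + 1"
      moreover from this have "(n + 2) div 3 = q" by presburger
      ultimately show ?thesis by (simp add: algebra_simps)
    next
      fix q assume "n + 1 = 3 * q + 1" "s = (c + 3) * q + 1"
      moreover from this have "(n + 2) div 3 = q" by presburger
      ultimately show ?thesis by (simp add: algebra_simps)
    next
      fix q assume "n + 1 = 3 * q + 2" "s = (c + 3) * (q + 1) \<or> s = (c + 3) * q + 2"
      moreover from this have "(n + 2) div 3 = q + 1" by presburger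
      ultimately show ?thesis by (auto simp: algebra_simps)
    qed simp
  next
    fix k x y
    assume k: "2 \<le> k" "k < n" "x \<in> leaf_sizes (Y_tree (c + 3) (k - 1))"
      "y \<in> leaf_sizes (comb_tree (c + 3) (n - (k + 1)))" "s = 1 + x + y"
    let ?r = "n - (k + 1)"
    have y: "y \<le> ?r + 2 + c * ((?r + 2) div 3)" using k by (intro less.IH) auto
    \<comment> \<open>This is the bound of the lemma evaluated at \<open>k - 1\<close>, so both
      shares have the same shape.\<close>
    have x: "1 + x \<le> k + 1 + c * ((k + 1) div 3)"
      using k(3)
    proof (rule leaf_sizes_Y_tree)
      fix q assume "k - 1 = 3 * q + 1" "x = (c + 3) * q + 1"
      moreover from this have "k = 3 * q + 2" by simp
      ultimately show ?thesis by (simp add: algebra_simps)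
    next
      fix q assume "k - 1 = 3 * q + 2" "x = (c + 3) * (q + 1)"
      moreover from this have "k = 3 * q + 3" by simp
      moreover from this have "(k + 1) div 3 = q + 1" by presburger
      ultimately show ?thesis by (simp add: algebra_simps)
    qed simp
    have n: "n = ?r + (k + 1)" using k by simp
    \<comment> \<open>\<open>div\<close> is superadditive, and the numerators on the left add up to
      \<open>n + 2\<close>.\<close>
    have "(k + 1) div 3 + (?r + 2) div 3 \<le> (n + 2) div 3"
      using n by presburger
    then have "c * ((k + 1) div 3) + c * ((?r + 2) div 3) \<le> c * ((n + 2) div 3)"
      unfolding distrib_left[symmetric] by (rule mult_le_mono2)
    then show ?thesis using x y n k(5) by linarith
  qed
qed

lemma leaf_sizes_le_d_max:
  assumes "s \<in> leaf_sizes (comb_tree m n)" "m \<ge> 2"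
  shows "int s - 1 \<le> d_max m n"
proof (cases "m = 2")
  case True
  then have "real_of_int (int s - 1) \<le> (3 * real n + 2) / 4"
    using leaf_sizes_comb_tree_2[of s n] assms(1) by simp
  then show ?thesis using True by (simp add: d_max_def le_floor_iff)
next
  case False
  then obtain c where c: "m = c + 3" using assms(2) that[of "m - 3"] by simp
  have "\<lfloor>(real n + 2) / 3\<rfloor> = int ((n + 2) div 3)"
    using floor_divide_of_nat_eq[of "n + 2" 3, where ?'a = real] by (simp add: add.commute)
  moreover have "int s \<le> int (n + 2 + c * ((n + 2) div 3))"
    using leaf_sizes_comb_tree_ge_3[of s c n] assms(1) unfolding c of_nat_le_iff by blast
  ultimately show ?thesis using c by (simp add: d_max_def)
qed

lemma d_max_nonneg:
  assumes "m \<ge> 2"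
  shows "d_max m n \<ge> 0"
proof -
  have "0 \<le> \<lfloor>(real n + 2) / 3\<rfloor>" "0 \<le> \<lfloor>(3 * real n + 2) / 4\<rfloor>" by simp_all
  then show ?thesis using assms by (auto simp: d_max_def)
qed

lemma face_dim_critical_cells:
  assumes "A \<in> critical_cells (Delta m n) (comb_tree m n)" "m \<ge> 2"
  shows "face_dim A \<le> d_max m n"
proof -
  obtain s where "s \<in> leaf_sizes (comb_tree m n)" "card A \<le> s"
    using assms card_final_leaves[of A _ "Delta m n" "{}" "{}" "comb_tree m n"]
    by (auto simp: critical_cells_def)
  then show ?thesis using leaf_sizes_le_d_max[OF _ assms(2)] by (force simp: face_dim_def)
qed

theorem theorem5p3:
  fixes m n :: nat and d :: int
  assumes "m \<ge> 2" and "d > d_max m n"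
  shows "C_num m n d = 0"
proof -
  \<comment> \<open>Positivity avoids the base 0-cell and the 0-sphere at \<open>n = 0\<close>,
    leaving only critical cells to count.\<close>
  have "d > 0" using d_max_nonneg[OF assms(1), of n] assms(2) by simp
  moreover have "{A \<in> critical_cells (Delta m n) (comb_tree m n). face_dim A = d} = {}"
    using face_dim_critical_cells[OF _ assms(1)] assms(2) by fastforce
  ultimately show ?thesis by (simp only: C_num_def num_cells_X_def) simp
qed

end
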